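(* Let $n \ge 1$ and let $T_1, T_2, T_3$ be any three trees, each on $n$ vertices. Then there exists a planar graph on at most $\frac{3}{2}n$ vertices that contains each of $T_1$, $T_2$, $T_3$ as a subgraph.
   Context: Contained as a subgraph means there is an injective map of vertices sending edges to edges. *)

theory Defs
  imports "HOL-Analysis.Analysis" "Graph_Theory.Graph_Theory"
begin

text \<open>
  A finite simple undirected graph is a \<^locale>\<open>pair_graph\<close>: finite, loop-free, and with a
  symmetric arc relation, so that the edge \<open>uv\<close> is represented by the two arcs
  \<open>(u, v)\<close> and \<open>(v, u)\<close>.

  The constant \<^const>\<open>tree\<close> of \<^theory>\<open>Graph_Theory.Digraph_Component\<close> cannot be used for such
  graphs, since there the closed walk \<open>[(u, v), (v, u)]\<close> counts as a cycle. Among the closed walks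
  satisfying \<^const>\<open>pre_digraph.cycle\<close>, the cycles of the undirected graph are those of length
  at least 3.
\<close>

definition undirected_tree :: "'a pair_pre_digraph \<Rightarrow> bool" where
  "undirected_tree T \<longleftrightarrow>
     pair_graph T \<and>
     Digraph_Component.connected (with_proj T) \<and>
     \<not> (\<exists>p. pre_digraph.cycle (with_proj T) p \<and> length p \<ge> 3)"

definition contains_as_subgraph :: "'a pair_pre_digraph \<Rightarrow> 'b pair_pre_digraph \<Rightarrow> bool" where
  "contains_as_subgraph G H \<longleftrightarrow>
     (\<exists>f. inj_on f (pverts H) \<and> f ` pverts H \<subseteq> pverts G \<and>
          (\<forall>(u, v) \<in> parcs H. (f u, f v) \<in> parcs G))"

text \<open>
  In a plane drawing, \<open>\<gamma> (u, v)\<close> is a simple curve from the point of \<open>u\<close> to the point of \<open>v\<close>.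
  The two arcs of an edge carry the same curve with opposite orientations, a curve passes through
  no vertex other than its ends, and the curves of two different edges meet only in the points
  of common end vertices.
\<close>

definition plane_drawing ::
    "'a pair_pre_digraph \<Rightarrow> ('a \<Rightarrow> real \<times> real) \<Rightarrow> ('a \<times> 'a \<Rightarrow> real \<Rightarrow> real \<times> real) \<Rightarrow> bool" where
  "plane_drawing G pos \<gamma> \<longleftrightarrow>
     inj_on pos (pverts G) \<and>
     (\<forall>(u, v) \<in> parcs G.
        Path_Connected.arc (\<gamma> (u, v)) \<and>
        pathstart (\<gamma> (u, v)) = pos u \<and> pathfinish (\<gamma> (u, v)) = pos v \<and>
        \<gamma> (v, u) = reversepath (\<gamma> (u, v)) \<and>
        path_image (\<gamma> (u, v)) \<inter> pos ` pverts G = {pos u, pos v}) \<and>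
     (\<forall>(u, v) \<in> parcs G. \<forall>(x, y) \<in> parcs G. {u, v} \<noteq> {x, y} \<longrightarrow>
        path_image (\<gamma> (u, v)) \<inter> path_image (\<gamma> (x, y)) \<subseteq> pos ` ({u, v} \<inter> {x, y}))"

definition planar_graph :: "'a pair_pre_digraph \<Rightarrow> bool" where
  "planar_graph G \<longleftrightarrow> pair_graph G \<and> (\<exists>pos \<gamma>. plane_drawing G pos \<gamma>)"

end

theory Submission
  imports Defs
begin

text \<open>
  Place vertices on three rays from the origin, \<open>n div 2\<close> on each ray, together with the origin
  itself if \<open>n\<close> is odd; these are at most \<open>3 n / 2\<close> points. Two consecutive rays form a line that
  carries exactly \<open>n\<close> vertices and bounds a sector. Every tree has a vertex ordering in which no
  two edges cross (insert a leaf right after its neighbour), so each of the three trees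
  can be drawn inside its own sector.
\<close>

section \<open>Noncrossing orderings of forests\<close>

text \<open>Phrased for a bare relation and a list of vertices, so that the later induction can
  delete a vertex without rebuilding a graph.\<close>

definition has_undirected_cycle :: "'a rel \<Rightarrow> bool" where
  "has_undirected_cycle E \<longleftrightarrow>
     (\<exists>xs. distinct xs \<and> 3 \<le> length xs \<and> set (vwalk_arcs (xs @ [hd xs])) \<subseteq> E)"

text \<open>For symmetric \<open>R\<close> this is the one-page book embedding condition: the
  forbidden pattern forces \<open>a < b\<close> and \<open>c < d\<close>, so it concerns the
  increasing orientation of each edge.\<close>

definition noncrossing :: "('a::linorder) rel \<Rightarrow> bool" where
  "noncrossing R \<longleftrightarrow>
     (\<forall>(a, b) \<in> R. \<forall>(c, d) \<in> R. \<not> (a < c \<and> c < b \<and> b < d))"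

lemma noncrossingD:
  "noncrossing R \<Longrightarrow> (a, b) \<in> R \<Longrightarrow> (c, d) \<in> R \<Longrightarrow> a < c \<Longrightarrow> c < b \<Longrightarrow> b < d \<Longrightarrow> False"
  unfolding noncrossing_def by blast

lemma noncrossing_map_prod_strict_mono:
  assumes "noncrossing R" "strict_mono f"
  shows "noncrossing (map_prod f f ` R)"
  using assms unfolding noncrossing_def by (fastforce simp: strict_mono_less)

text \<open>Bridge from walks given as vertex lists to the arc lists on which \<open>cycle\<close>
  is defined.\<close>

lemma vwalk_arcs_cas_verts:
  "ys \<noteq> [] \<Longrightarrow> pcas (hd ys) (vwalk_arcs ys) (last ys) \<and> pawalk_verts (hd ys) (vwalk_arcs ys) = ys"
  by (induction ys rule: vwalk_arcs.induct) auto

lemma undirected_tree_no_cycle: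
  assumes "undirected_tree T"
  shows "\<not> has_undirected_cycle (parcs T)"
proof
  assume "has_undirected_cycle (parcs T)"
  then obtain xs where xs: "distinct xs" "3 \<le> length xs"
      and arcs: "set (vwalk_arcs (xs @ [hd xs])) \<subseteq> parcs T"
    unfolding has_undirected_cycle_def by blast
  interpret pair_graph T using assms unfolding undirected_tree_def by blast
  let ?ys = "xs @ [hd xs]"
  from xs obtain x y zs where xs_eq: "xs = x # y # zs" by (cases xs; cases "tl xs") auto
  \<comment> \<open>Closing the list adds one vertex, so the walk has as many arcs as
    \<open>xs\<close> has vertices, and the two bounds of 3 agree.\<close>
  have len: "length (vwalk_arcs ?ys) = length xs"
    using vwalk_length_simp[of ?ys] unfolding vwalk_length_def by simp
  have "awalk x (vwalk_arcs ?ys) x"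
    using vwalk_arcs_cas_verts[of ?ys] arcs xs_eq unfolding awalk_def
    by (auto dest: in_arcsD1)
  moreover have "distinct (tl (pawalk_verts x (vwalk_arcs ?ys)))"
    using vwalk_arcs_cas_verts[of ?ys] xs xs_eq by auto
  ultimately have "cycle (vwalk_arcs ?ys)"
    unfolding cycle_def using len xs(2) by (metis list.size(3) not_numeral_le_zero)
  then show False using assms len xs(2) unfolding undirected_tree_def by auto
qed

text \<open>An end of a longest path has all its neighbours on the path.\<close>

lemma forest_has_vertex_of_degree_at_most_1:
  assumes "finite V" "V \<noteq> {}" "E \<subseteq> V \<times> V" "sym E" "irrefl E" "\<not> has_undirected_cycle E"
  obtains v where "v \<in> V" "\<And>a b. (v, a) \<in> E \<Longrightarrow> (v, b) \<in> E \<Longrightarrow> a = b"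
proof -
  define P where
    "P xs \<longleftrightarrow> xs \<noteq> [] \<and> distinct xs \<and> set xs \<subseteq> V \<and> set (vwalk_arcs xs) \<subseteq> E" for xs
  obtain w where "P [w]" using assms(2) by (auto simp: P_def)
  moreover have "\<forall>ys. P ys \<longrightarrow> length ys < Suc (card V)"
    using assms(1) card_mono by (fastforce simp: P_def less_Suc_eq_le simp flip: distinct_card)
  ultimately have "\<exists>xs. P xs \<and> (\<forall>ys. P ys \<longrightarrow> length ys \<le> length xs)"
    by (rule ex_has_greatest_nat)
  then obtain xs where xs: "P xs" and longest: "\<And>ys. P ys \<Longrightarrow> length ys \<le> length xs"
    by blast
  \<comment> \<open>A neighbour off the path would extend it, and one at index 2 or later would
    close a cycle; only index 1 is left. For a path of length 1 the claim is vacuous, so the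
    out-of-range \<open>xs ! 1\<close> is harmless.\<close>
  have nbr: "a = xs ! 1" if "(hd xs, a) \<in> E" for a
  proof -
    have "(a, hd xs) \<in> E" using that assms(4) by (meson symD)
    have "a \<in> set xs"
    proof (rule ccontr)
      assume "a \<notin> set xs"
      then have "P (a # xs)"
        using xs \<open>(a, hd xs) \<in> E\<close> assms(3) unfolding P_def by auto
      then show False using longest by fastforce
    qed
    then obtain i where i: "i < length xs" "a = xs ! i" by (metis in_set_conv_nth)
    have "i \<noteq> 0"
    proof
      assume "i = 0"
      then show False using that assms(5) i xs unfolding P_def irrefl_def
        by (metis hd_conv_nth)
    qed
    moreover have "\<not> 2 \<le> i"
    proof
      assume "2 \<le> i"
      let ?c = "take (Suc i) xs"
      have c: "?c \<noteq> []" "hd ?c = hd xs" "last ?c = a" "length ?c = Suc i"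
        using i xs by (auto simp: P_def take_Suc_conv_app_nth hd_append hd_conv_nth)
      have "set (vwalk_arcs ?c) \<subseteq> set (vwalk_arcs (?c @ drop (Suc i) xs))"
        by (rule set_vwalk_arcs_append1)
      also have "\<dots> \<subseteq> E" using xs by (simp add: P_def)
      finally have "set (vwalk_arcs (?c @ [hd ?c])) \<subseteq> E"
        using set_vwalk_arcs_snoc[OF c(1), of "hd ?c"] c \<open>(a, hd xs) \<in> E\<close> by simp
      moreover have "distinct ?c" "3 \<le> length ?c"
        using xs c \<open>2 \<le> i\<close> by (auto simp: P_def)
      ultimately show False using assms(6) unfolding has_undirected_cycle_def by blast
    qed
    ultimately have "i = 1" by linarith
    then show ?thesis using i by simp
  qed
  show thesis
  proof
    show "hd xs \<in> V" using xs by (auto simp: P_def)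
    show "a = b" if "(hd xs, a) \<in> E" "(hd xs, b) \<in> E" for a b
      using nbr that by metis
  qed
qed

text \<open>Induction on the number of vertices: remove a vertex of degree at most 1, order the
  rest, and reinsert it right after its neighbour. Forests are closed under deleting a vertex, so
  the induction hypothesis applies directly.\<close>

lemma forest_noncrossing_ordering:
  assumes "finite V" "E \<subseteq> V \<times> V" "sym E" "irrefl E" "\<not> has_undirected_cycle E"
  shows "\<exists>h. bij_betw h V {..<card V} \<and> noncrossing (map_prod h h ` E)"
  using assms
proof (induction "card V" arbitrary: V E)
  case 0
  then show ?case by (auto simp: noncrossing_def bij_betw_def)
next
  case (Suc n)
  have "V \<noteq> {}" using Suc.hyps(2) by auto
  then obtain v where v: "v \<in> V" and deg: "\<And>a b. (v, a) \<in> E \<Longrightarrow> (v, b) \<in> E \<Longrightarrow> a = b"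
    using forest_has_vertex_of_degree_at_most_1[OF Suc.prems(1) _ Suc.prems(2-5)] by blast
  define W where "W = V - {v}"
  define F where "F = E \<inter> W \<times> W"
  have cW: "card W = n" using Suc.hyps(2) v Suc.prems(1) by (simp add: W_def)
  have "\<not> has_undirected_cycle F"
    using Suc.prems(5) unfolding has_undirected_cycle_def F_def by blast
  moreover have "sym F" "irrefl F"
    using Suc.prems(3,4) by (auto simp: F_def sym_def irrefl_def)
  moreover have "finite W" "F \<subseteq> W \<times> W" using Suc.prems(1) by (auto simp: W_def F_def)
  ultimately obtain h where h: "bij_betw h W {..<n}" "noncrossing (map_prod h h ` F)"
    using Suc.hyps(1)[of W F] cW by auto
  have hn: "h w < n" if "w \<in> W" for w using h(1) that by (auto simp: bij_betw_def)
  \<comment> \<open>The position of \<open>v\<close>: just behind its neighbour, which is unique by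
    \<open>deg\<close>, or last if \<open>v\<close> is isolated.\<close>
  define s where "s = (if \<exists>u. (v, u) \<in> E then Suc (h (SOME u. (v, u) \<in> E)) else n)"
  have W_nbr: "u \<in> W" if "(v, u) \<in> E" for u
    using that Suc.prems(2,4) by (auto simp: W_def irrefl_def)
  have s_nbr: "s = Suc (h u)" if "(v, u) \<in> E" for u
    using that deg[OF that] someI[of "\<lambda>u. (v, u) \<in> E", OF that] unfolding s_def by metis
  have "s \<le> n"
  proof (cases "\<exists>u. (v, u) \<in> E")
    case True
    then obtain u where "(v, u) \<in> E" by blast
    then show ?thesis using s_nbr[of u] hn[OF W_nbr[of u]] by simp
  qed (simp add: s_def)
  \<comment> \<open>Positions from \<open>s\<close> on move up by one to make room for
    \<open>v\<close>; on \<open>W\<close> the order given by \<open>h\<close> is kept.\<close>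
  define g where "g w = (if w = v then s else if h w < s then h w else Suc (h w))" for w
  have inj_h: "inj_on h W" using h(1) by (auto simp: bij_betw_def)
  have "inj_on g V"
    unfolding inj_on_def using inj_h by (auto simp: g_def W_def inj_on_def split: if_splits)
  moreover have "g ` V \<subseteq> {..<card V}"
    using hn \<open>s \<le> n\<close> Suc.hyps(2) by (force simp: g_def W_def)
  ultimately have "bij_betw g V {..<card V}"
    unfolding bij_betw_def by (simp add: card_image card_subset_eq)
  moreover have "noncrossing (map_prod g g ` E)"
  proof -
    have False if ab: "(a, b) \<in> E" and cd: "(c, d) \<in> E"
      and cr: "g a < g c" "g c < g b" "g b < g d" for a b c d
    proof -
      \<comment> \<open>Edges at \<open>v\<close> join consecutive positions, whereas each edge of a
        crossing has an end of the other strictly between its own ends. So no crossing involves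
        \<open>v\<close>, and any other one already occurs in \<open>F\<close>.\<close>
      have at_v: "Suc (g x) = g v" if "(v, x) \<in> E \<or> (x, v) \<in> E" for x
      proof -
        have "(v, x) \<in> E" using that Suc.prems(3) by (meson symD)
        then show ?thesis using s_nbr[of x] W_nbr[of x] by (auto simp: g_def W_def)
      qed
      have "a \<noteq> v" using at_v[of b] ab cr by fastforce
      moreover have "b \<noteq> v" using at_v[of a] ab cr by fastforce
      moreover have "c \<noteq> v" using at_v[of d] cd cr by fastforce
      moreover have "d \<noteq> v" using at_v[of c] cd cr by fastforce
      ultimately have "(a, b) \<in> F" "(c, d) \<in> F" "h a < h c" "h c < h b" "h b < h d"
        using ab cd cr Suc.prems(2) by (auto simp: F_def W_def g_def split: if_splits)
      then show False using noncrossingD[OF h(2), of "h a" "h b" "h c" "h d"] by force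
    qed
    then show ?thesis unfolding noncrossing_def by fastforce
  qed
  ultimately show ?case by blast
qed

lemma undirected_tree_noncrossing_ordering:
  assumes "undirected_tree T"
  obtains h where "bij_betw h (pverts T) {..<card (pverts T)}"
    "noncrossing (map_prod h h ` parcs T)"
proof -
  interpret pair_graph T using assms unfolding undirected_tree_def by blast
  have "sym (parcs T)" using pair_sym_arcs unfolding symmetric_def by simp
  moreover have "irrefl (parcs T)" using pair_no_loops by (fastforce simp: irrefl_def)
  moreover have "parcs T \<subseteq> pverts T \<times> pverts T" by (auto dest: in_arcsD1 in_arcsD2)
  ultimately show thesis
    using forest_noncrossing_ordering[OF pair_finite_verts _ _ _ undirected_tree_no_cycle[OF assms]]
      that by blast
qed

section \<open>Drawing in a half-plane and in a sector\<close>

text \<open>An arc of the parabola with zeros \<open>i\<close> and \<open>j\<close> and leading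
  coefficient -1. All these parabolas are translates of one another, so two different ones meet at
  most once.\<close>

definition half_plane_arc :: "real \<Rightarrow> real \<Rightarrow> real \<Rightarrow> real \<times> real" where
  "half_plane_arc i j t = (let x = (1 - t) * i + t * j in (x, (x - i) * (j - x)))"

text \<open>Three directions with sum zero, so consecutive ones span convex sectors that tile the
  plane. Reduction modulo 3 lets the last sector end at \<open>ray 0\<close>.\<close>

definition ray :: "nat \<Rightarrow> real \<times> real" where
  "ray m = (if m mod 3 = 0 then (1, 0) else if m mod 3 = 1 then (0, 1) else (- 1, - 1))"

text \<open>
  A homeomorphism from the closed upper half-plane onto the sector between \<open>ray m\<close> and
  \<open>ray (m + 1)\<close>: of the two coefficients, \<open>x\<close> is the difference and \<open>y\<close> the minimum.
\<close>

definition sector :: "nat \<Rightarrow> real \<times> real \<Rightarrow> real \<times> real" where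
  "sector m = (\<lambda>(x, y). (max x 0 + y) *\<^sub>R ray m + (max (- x) 0 + y) *\<^sub>R ray (Suc m))"

section \<open>Injectivity and disjointness of the sector maps\<close>

lemma sector_simps:
  "sector 0 (x, y) = (max x 0 + y, max (- x) 0 + y)"
  "sector 1 (x, y) = (- (max (- x) 0 + y), max x 0 - max (- x) 0)"
  "sector 2 (x, y) = (max (- x) 0 - max x 0, - (max x 0 + y))"
  by (simp_all add: sector_def ray_def flip: numeral_2_eq_2)

lemma sector_index_cases: "m < 3 \<Longrightarrow> m = 0 \<or> m = 1 \<or> m = (2 :: nat)"
  by auto

text \<open>Consecutive rays are linearly independent, so a point of the sector determines both
  coefficients, and these determine \<open>x\<close> and \<open>y\<close>.\<close>

lemma sector_inj:
  assumes "m < 3" "0 \<le> snd p" "0 \<le> snd q" "sector m p = sector m q"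
  shows "p = q"
proof -
  obtain x y x' y' where "p = (x, y)" "q = (x', y')" by (cases p; cases q)
  then show ?thesis using sector_index_cases[OF assms(1)] assms(2-)
    by (elim disjE) (auto simp only: sector_simps prod.inject snd_conv max_def split: if_splits)
qed

text \<open>Positive height makes both coefficients positive, which puts the point strictly between
  its two rays. Only \<open>p\<close> is required to be off the axis, so \<open>q\<close> may also
  be a vertex.\<close>

lemma sector_interior_disjoint:
  assumes "m < 3" "m' < 3" "0 < snd p" "0 \<le> snd q" "sector m p = sector m' q"
  shows "m = m'"
proof -
  obtain x y x' y' where "p = (x, y)" "q = (x', y')" by (cases p; cases q)
  then show ?thesis
    using sector_index_cases[OF assms(1)] sector_index_cases[OF assms(2)] assms(3-)
    by (elim disjE) (auto simp only: sector_simps prod.inject snd_conv max_def split: if_splits)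
qed

lemma continuous_on_sector: "continuous_on S (sector m)"
  unfolding sector_def case_prod_beta by (intro continuous_intros)

section \<open>Parabolic arcs over the axis\<close>

lemma half_plane_arc_ends [simp]:
  "half_plane_arc i j 0 = (i, 0)" "half_plane_arc i j 1 = (j, 0)"
  by (simp_all add: half_plane_arc_def)

lemma snd_half_plane_arc: "snd (half_plane_arc i j t) = t * (1 - t) * (j - i)\<^sup>2"
  by (simp add: half_plane_arc_def Let_def algebra_simps power2_eq_square)

lemma snd_half_plane_arc_nonneg: "t \<in> {0..1} \<Longrightarrow> 0 \<le> snd (half_plane_arc i j t)"
  unfolding snd_half_plane_arc by auto

lemma snd_half_plane_arc_pos: "t \<in> {0<..<1} \<Longrightarrow> i \<noteq> j \<Longrightarrow> 0 < snd (half_plane_arc i j t)"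
  unfolding snd_half_plane_arc by auto

lemma half_plane_arc_reverse: "half_plane_arc j i t = half_plane_arc i j (1 - t)"
  by (simp add: half_plane_arc_def Let_def algebra_simps)

lemma half_plane_arc_inj: "i \<noteq> j \<Longrightarrow> half_plane_arc i j t = half_plane_arc i j t' \<Longrightarrow> t = t'"
proof -
  assume "i \<noteq> j" "half_plane_arc i j t = half_plane_arc i j t'"
  then have "(t - t') * (j - i) = 0"
    by (simp add: half_plane_arc_def Let_def algebra_simps)
  then show ?thesis using \<open>i \<noteq> j\<close> by simp
qed

lemma arc_sector_half_plane_arc:
  assumes "m < 3" "i \<noteq> j"
  shows "Path_Connected.arc (sector m \<circ> half_plane_arc i j)"
proof -
  have "continuous_on {0..1} (half_plane_arc i j)"
    unfolding half_plane_arc_def Let_def by (intro continuous_intros)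
  then have "path (sector m \<circ> half_plane_arc i j)"
    unfolding path_def by (intro continuous_on_compose continuous_on_sector)
  moreover have "inj_on (sector m \<circ> half_plane_arc i j) {0..1}"
  proof (rule inj_onI)
    fix t t' :: real assume t: "t \<in> {0..1}" "t' \<in> {0..1}"
      and "(sector m \<circ> half_plane_arc i j) t = (sector m \<circ> half_plane_arc i j) t'"
    then have "half_plane_arc i j t = half_plane_arc i j t'"
      using sector_inj[OF assms(1) snd_half_plane_arc_nonneg[OF t(1)] snd_half_plane_arc_nonneg[OF t(2)]]
      by simp
    then show "t = t'" by (rule half_plane_arc_inj[OF assms(2)])
  qed
  ultimately show ?thesis unfolding Path_Connected.arc_def by blast
qed

text \<open>Both intervals contain \<open>x\<close> and do not interleave, so if their left ends
  differ, one contains the other. The outer parabola is then strictly higher at \<open>x\<close>. If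
  the left ends agree, cancelling the positive factor \<open>x - i\<close> gives
  \<open>j = l\<close>.\<close>

lemma parabolas_disjoint:
  fixes i j k l x :: real
  assumes "i < x" "x < j" "k < x" "x < l" "(x - i) * (j - x) = (x - k) * (l - x)"
    and "\<not> (i < k \<and> k < j \<and> j < l)" "\<not> (k < i \<and> i < l \<and> l < j)"
  shows "i = k \<and> j = l"
proof (cases i k rule: linorder_cases)
  case less
  then have "(x - k) * (l - x) < (x - i) * (j - x)"
    using assms by (intro mult_less_le_imp_less) auto
  then show ?thesis using assms by simp
next
  case greater
  then have "(x - i) * (j - x) < (x - k) * (l - x)"
    using assms by (intro mult_less_le_imp_less) auto
  then show ?thesis using assms by simp
qed (use assms in auto)

lemma half_plane_arc_between:
  assumes "i < j" "t \<in> {0<..<1}"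
  obtains x where "i < x" "x < j" "half_plane_arc i j t = (x, (x - i) * (j - x))"
proof
  let ?x = "(1 - t) * i + t * j"
  have "0 < t * (j - i)" "0 < (1 - t) * (j - i)" using assms by auto
  then show "i < ?x" "?x < j" by (simp_all add: algebra_simps)
qed (simp add: half_plane_arc_def Let_def)

lemma noncrossing_arcs_disjoint:
  assumes R: "noncrossing R" "sym R" "irrefl R" "(i, j) \<in> R" "(k, l) \<in> R"
    and t: "t \<in> {0<..<1}" "t' \<in> {0<..<1}" and eq: "half_plane_arc i j t = half_plane_arc k l t'"
  shows "{i, j} = {k, l}"
proof -
  \<comment> \<open>Reversing an edge keeps its curve, so both edges can be taken from left to
    right, as \<open>half_plane_arc_between\<close> and \<open>parabolas_disjoint\<close>
    require.\<close>
  have oriented: "\<exists>a b s. a < b \<and> (a, b) \<in> R \<and> {a, b} = {i, j} \<and> s \<in> {0<..<1} \<and>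
      half_plane_arc a b s = half_plane_arc i j t"
    if "(i, j) \<in> R" "t \<in> {0<..<1}" for i j t
  proof (cases "i < j")
    case False
    then have "j < i" using that R(3) by (auto simp: irrefl_def not_less less_le)
    moreover have "(j, i) \<in> R" using that R(2) by (meson symD)
    moreover have "1 - t \<in> {0<..<1}" using that by auto
    ultimately show ?thesis
      using half_plane_arc_reverse[of i j t] half_plane_arc_reverse[of j i "1 - t"]
      by (metis insert_commute)
  qed (use that in blast)
  obtain a b s where ab: "a < b" "(a, b) \<in> R" "{a, b} = {i, j}" "s \<in> {0<..<1}"
      "half_plane_arc a b s = half_plane_arc i j t"
    using oriented[OF R(4) t(1)] by blast
  obtain c d s' where cd: "c < d" "(c, d) \<in> R" "{c, d} = {k, l}" "s' \<in> {0<..<1}"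
      "half_plane_arc c d s' = half_plane_arc k l t'"
    using oriented[OF R(5) t(2)] by blast
  obtain x where x: "a < x" "x < b" "half_plane_arc a b s = (x, (x - a) * (b - x))"
    using half_plane_arc_between[OF ab(1,4)] .
  obtain y where y: "c < y" "y < d" "half_plane_arc c d s' = (y, (y - c) * (d - y))"
    using half_plane_arc_between[OF cd(1,4)] .
  have "x = y" "(x - a) * (b - x) = (y - c) * (d - y)" using x y ab cd eq by auto
  then have "a = c \<and> b = d"
    using x y noncrossingD[OF R(1) ab(2) cd(2)] noncrossingD[OF R(1) cd(2) ab(2)]
    by (intro parabolas_disjoint[of a x b c d]) auto
  then show ?thesis using ab cd by simp
qed

section \<open>Gluing three sectors\<close>

text \<open>Each \<open>R m\<close> is drawn by parabolic arcs over the axis and carried into its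
  sector. Curves of one sector are kept apart by \<open>noncrossing\<close>, those of different
  sectors by the disjointness of the interiors. Numbering the points of \<open>P\<close> gives
  vertices of type \<open>nat\<close>.\<close>

lemma planar_graph_of_three_sectors:
  fixes I :: "real set" and R :: "nat \<Rightarrow> real rel"
  defines "P \<equiv> (\<Union>m<3. (\<lambda>i. sector m (i, 0)) ` I)"
  assumes "finite I"
    and R: "\<And>m. m < 3 \<Longrightarrow> R m \<subseteq> I \<times> I" "\<And>m. m < 3 \<Longrightarrow> sym (R m)"
      "\<And>m. m < 3 \<Longrightarrow> irrefl (R m)" "\<And>m. m < 3 \<Longrightarrow> noncrossing (R m)"
  shows "\<exists>G :: nat pair_pre_digraph. planar_graph G \<and> card (pverts G) = card P \<and>
    (\<forall>m<3. \<exists>g. inj_on g I \<and> g ` I \<subseteq> pverts G \<and> (\<forall>(i, j) \<in> R m. (g i, g j) \<in> parcs G))"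
proof -
  have "finite P" using assms(2) by (auto simp: P_def)
  then obtain pos where pos: "bij_betw pos {0..<card P} P"
    using ex_bij_betw_nat_finite by blast
  let ?V = "{0..<card P}"
  \<comment> \<open>The vertex at coordinate \<open>i\<close> on the boundary line of sector
    \<open>m\<close>. A point of a ray may be named from both adjacent sectors, with opposite signs
    of \<open>i\<close>; this is where the trees share vertices.\<close>
  define code where "code m i = inv_into ?V pos (sector m (i, 0))" for m i
  have code: "code m i \<in> ?V" "pos (code m i) = sector m (i, 0)" if "m < 3" "i \<in> I" for m i
  proof -
    have "sector m (i, 0) \<in> pos ` ?V" using that pos by (auto simp: P_def bij_betw_def)
    then show "code m i \<in> ?V" "pos (code m i) = sector m (i, 0)"
      unfolding code_def by (rule inv_into_into, rule f_inv_into_f)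
  qed
  have code_inj: "inj_on (code m) I" if "m < 3" for m
  proof (rule inj_onI)
    fix i j assume "i \<in> I" "j \<in> I" "code m i = code m j"
    then have "sector m (i, 0) = sector m (j, 0)" using code(2)[OF that] by metis
    then show "i = j" using sector_inj[OF that, of "(i, 0)" "(j, 0)"] by simp
  qed
  define A where "A m = map_prod (code m) (code m) ` R m" for m
  have A_sym: "(v, u) \<in> A m" if "m < 3" "(u, v) \<in> A m" for u v m
    using that R(2)[OF that(1)] by (force simp: A_def dest: symD)
  define G where "G = \<lparr>pverts = ?V, parcs = (\<Union>m<3. A m)\<rparr>"
  \<comment> \<open>an edge may occur in several trees; it is drawn in the first possible sector\<close>
  define sec where "sec u v = (LEAST m. m < 3 \<and> (u, v) \<in> A m)" for u v
  define idx where "idx m = inv_into I (code m)" for m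
  define \<gamma> where
    "\<gamma> = (\<lambda>(u, v). sector (sec u v) \<circ> half_plane_arc (idx (sec u v) u) (idx (sec u v) v))"
  have edge: "\<exists>m i j. m < 3 \<and> (i, j) \<in> R m \<and> i \<in> I \<and> j \<in> I \<and> i \<noteq> j \<and>
      u = code m i \<and> v = code m j \<and>
      \<gamma> (u, v) = sector m \<circ> half_plane_arc i j \<and> \<gamma> (v, u) = sector m \<circ> half_plane_arc j i"
    if "(u, v) \<in> parcs G" for u v
  proof -
    obtain m where sec: "sec u v = m" by blast
    have "\<exists>m. m < 3 \<and> (u, v) \<in> A m" using that by (auto simp: G_def)
    then have m: "m < 3" "(u, v) \<in> A m"
      using LeastI_ex[of "\<lambda>m. m < 3 \<and> (u, v) \<in> A m"] sec unfolding sec_def by auto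
    \<comment> \<open>Both arcs of an edge must choose the same sector, since their curves have to
      be reverses of each other.\<close>
    have "(\<lambda>m. m < 3 \<and> (u, v) \<in> A m) = (\<lambda>m. m < 3 \<and> (v, u) \<in> A m)" using A_sym by blast
    then have sec_sym: "sec v u = m" using sec unfolding sec_def by simp
    obtain i j where ij: "(i, j) \<in> R m" "u = code m i" "v = code m j"
      using m by (auto simp: A_def)
    have I: "i \<in> I" "j \<in> I" "i \<noteq> j"
      using ij(1) R(1)[OF m(1)] R(3)[OF m(1)] by (auto simp: irrefl_def)
    have "idx m u = i" "idx m v = j"
      unfolding idx_def ij(2,3) using code_inj[OF m(1)] I by simp_all
    then have "\<gamma> (u, v) = sector m \<circ> half_plane_arc i j" "\<gamma> (v, u) = sector m \<circ> half_plane_arc j i"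
      unfolding \<gamma>_def by (simp_all add: sec sec_sym)
    then show ?thesis using m(1) ij I by blast
  qed
  have pos_inj: "inj_on pos ?V" using pos by (simp add: bij_betw_def)
  have on_ray: "\<exists>m i. m < 3 \<and> pos w = sector m (i, 0)" if "w \<in> ?V" for w
  proof -
    have "pos w \<in> P" using pos that by (rule bij_betwE[THEN bspec])
    then show ?thesis by (auto simp: P_def)
  qed
  have "pair_graph G"
  proof
    show "finite (parcs G)"
    proof (rule finite_subset)
      show "parcs G \<subseteq> ?V \<times> ?V" using edge code(1) by (auto, blast+)
    qed simp
    show "symmetric (with_proj G)"
      using A_sym by (auto simp: symmetric_def sym_def G_def)
    fix e assume e: "e \<in> parcs G"
    then obtain u v where "e = (u, v)" by (cases e)
    from edge[of u v] e this obtain m i j where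
      m: "m < 3" "i \<in> I" "j \<in> I" "i \<noteq> j" "e = (code m i, code m j)" by blast
    then show "fst e \<in> pverts G" "snd e \<in> pverts G" using code(1) by (auto simp: G_def)
    show "fst e \<noteq> snd e" using m code_inj by (auto simp: inj_on_def)
  qed (simp add: G_def)
  \<comment> \<open>points of an edge curve: its two ends, or points in the interior of its sector\<close>
  have image: "path_image (sector m \<circ> half_plane_arc i j) =
      {sector m (i, 0), sector m (j, 0)} \<union> (sector m \<circ> half_plane_arc i j) ` {0<..<1}" for m i j
  proof -
    have "{0..1::real} = {0, 1} \<union> {0<..<1}" by auto
    then show ?thesis unfolding path_image_def by simp
  qed
  \<comment> \<open>The point has positive height in sector \<open>m\<close>, while a vertex has
    height 0 in some sector \<open>m'\<close>. Disjointness gives \<open>m = m'\<close>, and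
    injectivity then equates the two heights.\<close>
  have avoid: "sector m (half_plane_arc i j t) \<noteq> pos w"
    if t: "m < 3" "i \<noteq> j" "t \<in> {0<..<1}" "w \<in> ?V" for m i j t w
  proof
    assume eq: "sector m (half_plane_arc i j t) = pos w"
    obtain m' k where k: "m' < 3" "pos w = sector m' (k, 0)" using on_ray[OF t(4)] by blast
    have "m = m'"
      using sector_interior_disjoint[OF t(1) k(1) snd_half_plane_arc_pos[OF t(3,2)], of "(k, 0)"]
        eq k by simp
    then have "half_plane_arc i j t = (k, 0)"
      using sector_inj[OF t(1), of "half_plane_arc i j t" "(k, 0)"] eq k
        snd_half_plane_arc_pos[OF t(3,2)] by simp
    then show False using snd_half_plane_arc_pos[OF t(3,2)] by simp
  qed
  have "plane_drawing G pos \<gamma>"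
    unfolding plane_drawing_def
  proof (intro conjI ballI; (clarify)?)
    show "inj_on pos (pverts G)" using pos_inj by (simp add: G_def)
  next
    fix u v assume "(u, v) \<in> parcs G"
    then obtain m i j where e: "m < 3" "(i, j) \<in> R m" "i \<in> I" "j \<in> I" "i \<noteq> j"
        "u = code m i" "v = code m j"
        "\<gamma> (u, v) = sector m \<circ> half_plane_arc i j" "\<gamma> (v, u) = sector m \<circ> half_plane_arc j i"
      using edge by blast
    have uv: "u \<in> ?V" "v \<in> ?V" "pos u = sector m (i, 0)" "pos v = sector m (j, 0)"
      using e code by auto
    have "(sector m \<circ> half_plane_arc i j) ` {0<..<1} \<inter> pos ` ?V = {}"
      using avoid[OF e(1,5), THEN not_sym] by auto
    moreover have "{pos u, pos v} \<subseteq> pos ` ?V" using uv by blast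
    ultimately have "path_image (\<gamma> (u, v)) \<inter> pos ` pverts G = {pos u, pos v}"
      unfolding e(8) image uv(3,4)[symmetric] by (simp add: G_def)
    then show "Path_Connected.arc (\<gamma> (u, v)) \<and>
        pathstart (\<gamma> (u, v)) = pos u \<and> pathfinish (\<gamma> (u, v)) = pos v \<and>
        \<gamma> (v, u) = reversepath (\<gamma> (u, v)) \<and>
        path_image (\<gamma> (u, v)) \<inter> pos ` pverts G = {pos u, pos v}"
      using arc_sector_half_plane_arc[OF e(1,5)] uv
      by (auto simp: e(8,9) pathstart_def pathfinish_def reversepath_def half_plane_arc_reverse[of j i])
  next
    fix u v x y p
    assume uv: "(u, v) \<in> parcs G" and xy: "(x, y) \<in> parcs G" and ne: "{u, v} \<noteq> {x, y}"
      and p: "p \<in> path_image (\<gamma> (u, v))" "p \<in> path_image (\<gamma> (x, y))"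
    obtain m i j where e: "m < 3" "(i, j) \<in> R m" "i \<in> I" "j \<in> I" "i \<noteq> j"
        "u = code m i" "v = code m j" "\<gamma> (u, v) = sector m \<circ> half_plane_arc i j"
      using edge[OF uv] by blast
    obtain m' k l where e': "m' < 3" "(k, l) \<in> R m'" "k \<in> I" "l \<in> I" "k \<noteq> l"
        "x = code m' k" "y = code m' l" "\<gamma> (x, y) = sector m' \<circ> half_plane_arc k l"
      using edge[OF xy] by blast
    have V: "u \<in> ?V" "v \<in> ?V" "x \<in> ?V" "y \<in> ?V" using e e' code by auto
    have p1: "p \<in> pos ` {u, v} \<or> (\<exists>t \<in> {0<..<1}. p = sector m (half_plane_arc i j t))"
      using p(1) code(2) e unfolding e(8) image by auto
    have p2: "p \<in> pos ` {x, y} \<or> (\<exists>t \<in> {0<..<1}. p = sector m' (half_plane_arc k l t))"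
      using p(2) code(2) e' unfolding e'(8) image by auto
    \<comment> \<open>A common point interior to the first curve is no vertex, so it is interior to
      the second as well. Both curves then lie in one sector, and \<open>noncrossing\<close> makes
      the edges equal.\<close>
    have "\<not> (\<exists>t \<in> {0<..<1}. p = sector m (half_plane_arc i j t))"
    proof
      assume "\<exists>t \<in> {0<..<1}. p = sector m (half_plane_arc i j t)"
      then obtain t where t: "t \<in> {0<..<1}" "p = sector m (half_plane_arc i j t)" by blast
      then have "p \<notin> pos ` {x, y}" using avoid[OF e(1,5) t(1)] V by auto
      then obtain t' where t': "t' \<in> {0<..<1}" "p = sector m' (half_plane_arc k l t')"
        using p2 by blast
      have pos_t: "0 < snd (half_plane_arc i j t)" "0 < snd (half_plane_arc k l t')"
        using snd_half_plane_arc_pos t(1) t'(1) e(5) e'(5) by blast+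
      have mm: "m = m'"
        using sector_interior_disjoint[OF e(1) e'(1) pos_t(1), of "half_plane_arc k l t'"] pos_t t t'
        by simp
      have "half_plane_arc i j t = half_plane_arc k l t'"
        using sector_inj[OF e(1), of "half_plane_arc i j t" "half_plane_arc k l t'"] pos_t t(2) t'(2) mm
        by simp
      then have "{i, j} = {k, l}"
        using noncrossing_arcs_disjoint[OF R(4,2,3)[OF e(1)] e(2) _ t(1) t'(1)] e'(2) mm by simp
      then have "code m ` {i, j} = code m' ` {k, l}" using mm by simp
      then have "{u, v} = {x, y}" unfolding e(6,7) e'(6,7) by simp
      then show False using ne by blast
    qed
    moreover have "\<not> (\<exists>t \<in> {0<..<1}. p = sector m' (half_plane_arc k l t))" if "p \<in> pos ` {u, v}"
      using avoid[OF e'(1,5)] that V by auto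
    ultimately have "p \<in> pos ` {u, v} \<inter> pos ` {x, y}" using p1 p2 by blast
    moreover have "pos ` ({u, v} \<inter> {x, y}) = pos ` {u, v} \<inter> pos ` {x, y}"
      by (rule inj_on_image_Int[OF pos_inj]) (use V in simp_all)
    ultimately show "p \<in> pos ` ({u, v} \<inter> {x, y})" by (simp only:)
  qed
  with \<open>pair_graph G\<close> have "planar_graph G" unfolding planar_graph_def by blast
  moreover have "card (pverts G) = card P" by (simp add: G_def)
  moreover have "\<exists>g. inj_on g I \<and> g ` I \<subseteq> pverts G \<and> (\<forall>(i, j) \<in> R m. (g i, g j) \<in> parcs G)"
    if "m < 3" for m
    using code_inj[OF that] code(1)[OF that] that
    by (intro exI[of _ "code m"]) (force simp: G_def A_def)
  ultimately show ?thesis by (intro exI[of _ G] conjI allI impI)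
qed

section \<open>Counting the points on the three rays\<close>

text \<open>For even \<open>n\<close> these are half-integers, so that the origin is used for odd \<open>n\<close> only.\<close>

definition centered :: "nat \<Rightarrow> nat \<Rightarrow> real" where
  "centered n i = real i - (real n - 1) / 2"

lemma strict_mono_centered: "strict_mono (centered n)"
  by (simp add: strict_mono_def centered_def)

text \<open>The coordinates are symmetric about 0, so the two sectors at a ray use the same
  \<open>n div 2\<close> nonzero points on it. With the origin for odd \<open>n\<close>, the total
  is at most \<open>3 * (n div 2) + n mod 2\<close>.\<close>

lemma card_three_rays_le:
  "real (card (\<Union>m<3. (\<lambda>i. sector m (i, 0)) ` centered n ` {..<n})) \<le> 3 / 2 * real n"
proof -
  \<comment> \<open>The indices with positive coordinate: \<open>2 * i + 1 > n\<close> means that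
    \<open>i\<close> is at least \<open>n / 2\<close> rounded up.\<close>
  let ?J = "{(n + 1) div 2..<n}"
  let ?Q = "(\<lambda>(m, i). centered n i *\<^sub>R ray m) ` ({..<3} \<times> ?J)"
  let ?O = "if odd n then {0} else {} :: (real \<times> real) set"
  have in_Q: "centered n i *\<^sub>R ray m \<in> ?Q" if "0 < centered n i" "i < n" for m i
  proof -
    have "n < 2 * i + 1" using that(1) by (simp add: centered_def field_simps)
    then have "(m mod 3, i) \<in> {..<3} \<times> ?J" using that(2) by auto
    moreover have "ray (m mod 3) = ray m" by (simp add: ray_def)
    ultimately show ?thesis by (metis (mono_tags, lifting) case_prod_conv image_eqI)
  qed
  have "sector m (centered n i, 0) \<in> ?Q \<union> ?O" if "i < n" for m i
  proof (cases "centered n i" "0 :: real" rule: linorder_cases)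
    case less
    \<comment> \<open>Reflecting the index changes the sign, so the negative half of this line lands
      on the positive points of the next ray.\<close>
    have "- centered n i = centered n (n - 1 - i)"
      using that by (auto simp: centered_def field_simps of_nat_diff)
    then have "sector m (centered n i, 0) = centered n (n - 1 - i) *\<^sub>R ray (Suc m)"
      using less by (simp add: sector_def)
    then show ?thesis using in_Q[of "n - 1 - i" "Suc m"] that less \<open>- centered n i = _\<close> by auto
  next
    case equal
    then have "real n = real (2 * i + 1)" by (simp add: centered_def)
    then have "n = 2 * i + 1" by (simp only: of_nat_eq_iff)
    then show ?thesis using equal by (simp add: sector_def zero_prod_def)
  next
    case greater
    then have "sector m (centered n i, 0) = centered n i *\<^sub>R ray m" by (simp add: sector_def)
    then show ?thesis using in_Q[OF greater that] by simp
  qed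
  then have "(\<Union>m<3. (\<lambda>i. sector m (i, 0)) ` centered n ` {..<n}) \<subseteq> ?Q \<union> ?O" by blast
  then have "card (\<Union>m<3. (\<lambda>i. sector m (i, 0)) ` centered n ` {..<n}) \<le> card (?Q \<union> ?O)"
    by (rule card_mono[rotated]) auto
  also have "\<dots> \<le> card ?Q + card ?O" by (rule card_Un_le)
  also have "\<dots> \<le> 3 * (n div 2) + n mod 2"
  proof (rule add_mono)
    have "card ?Q \<le> card ({..<3::nat} \<times> ?J)" by (rule card_image_le) simp
    also have "\<dots> = 3 * (n div 2)" by (simp add: card_cartesian_product)
    finally show "card ?Q \<le> 3 * (n div 2)" .
    show "card ?O \<le> n mod 2" by (auto simp: odd_iff_mod_2_eq_one)
  qed
  finally have "2 * card (\<Union>m<3. (\<lambda>i. sector m (i, 0)) ` centered n ` {..<n}) \<le> 3 * n"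
    using div_mult_mod_eq[of n 2] by linarith
  then show ?thesis by linarith
qed

section \<open>Embedding the trees\<close>

lemma undirected_tree_centered_embedding:
  assumes "undirected_tree T" "card (pverts T) = n"
  obtains h where "bij_betw h (pverts T) (centered n ` {..<n})"
    "map_prod h h ` parcs T \<subseteq> centered n ` {..<n} \<times> centered n ` {..<n}"
    "sym (map_prod h h ` parcs T)" "irrefl (map_prod h h ` parcs T)"
    "noncrossing (map_prod h h ` parcs T)"
proof -
  interpret pair_graph T using assms(1) unfolding undirected_tree_def by blast
  obtain h where h: "bij_betw h (pverts T) {..<n}" "noncrossing (map_prod h h ` parcs T)"
    using undirected_tree_noncrossing_ordering[OF assms(1)] assms(2) by blast
  let ?h = "centered n \<circ> h"
  have bij: "bij_betw ?h (pverts T) (centered n ` {..<n})"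
    using h(1) strict_mono_imp_inj_on[OF strict_mono_centered]
    by (intro bij_betw_trans[OF h(1)]) (auto simp: bij_betw_def intro: inj_on_subset)
  have arcs: "parcs T \<subseteq> pverts T \<times> pverts T" by (auto dest: in_arcsD1 in_arcsD2)
  have map: "map_prod ?h ?h ` parcs T = map_prod (centered n) (centered n) ` map_prod h h ` parcs T"
    by (force simp: image_image)
  show thesis
  proof
    show "bij_betw ?h (pverts T) (centered n ` {..<n})" by (rule bij)
    show "map_prod ?h ?h ` parcs T \<subseteq> centered n ` {..<n} \<times> centered n ` {..<n}"
      using bij arcs unfolding bij_betw_def by fastforce
    show "sym (map_prod ?h ?h ` parcs T)"
      using pair_sym_arcs unfolding symmetric_def sym_def by force
    show "irrefl (map_prod ?h ?h ` parcs T)"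
      using bij arcs pair_no_loops unfolding irrefl_def bij_betw_def inj_on_def by fastforce
    show "noncrossing (map_prod ?h ?h ` parcs T)"
      unfolding map using h(2) strict_mono_centered by (rule noncrossing_map_prod_strict_mono)
  qed
qed

text \<open>The composite \<open>g \<circ> h\<close> is the injection. Passing through the common
  index set \<open>I\<close> treats trees with different vertex types alike.\<close>

lemma contains_as_subgraph_via_ordering:
  assumes "bij_betw h (pverts T) I"
    and "\<exists>g. inj_on g I \<and> g ` I \<subseteq> pverts G \<and>
      (\<forall>(i, j) \<in> map_prod h h ` parcs T. (g i, g j) \<in> parcs G)"
  shows "contains_as_subgraph G T"
proof -
  obtain g where g: "inj_on g I" "g ` I \<subseteq> pverts G"
      "\<forall>(i, j) \<in> map_prod h h ` parcs T. (g i, g j) \<in> parcs G"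
    using assms(2) by blast
  have "inj_on (g \<circ> h) (pverts T)" "(g \<circ> h) ` pverts T \<subseteq> pverts G"
    using assms(1) g(1,2) by (auto simp: bij_betw_def intro: comp_inj_on)
  moreover have "\<forall>(u, v) \<in> parcs T. ((g \<circ> h) u, (g \<circ> h) v) \<in> parcs G" using g(3) by force
  ultimately show ?thesis unfolding contains_as_subgraph_def by blast
qed

theorem theorem9:
  fixes n :: nat
    and T1 :: "'a pair_pre_digraph" and T2 :: "'b pair_pre_digraph" and T3 :: "'c pair_pre_digraph"
  assumes "n \<ge> 1"
    and "undirected_tree T1" and "card (pverts T1) = n"
    and "undirected_tree T2" and "card (pverts T2) = n"
    and "undirected_tree T3" and "card (pverts T3) = n"
  shows "\<exists>G :: nat pair_pre_digraph.
           planar_graph G \<and> real (card (pverts G)) \<le> 3 / 2 * real n \<and>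
           contains_as_subgraph G T1 \<and> contains_as_subgraph G T2 \<and> contains_as_subgraph G T3"
proof -
  let ?I = "centered n ` {..<n}"
  obtain h1 where h1: "bij_betw h1 (pverts T1) ?I" "map_prod h1 h1 ` parcs T1 \<subseteq> ?I \<times> ?I"
    "sym (map_prod h1 h1 ` parcs T1)" "irrefl (map_prod h1 h1 ` parcs T1)"
    "noncrossing (map_prod h1 h1 ` parcs T1)"
    using undirected_tree_centered_embedding[OF assms(2,3)] .
  obtain h2 where h2: "bij_betw h2 (pverts T2) ?I" "map_prod h2 h2 ` parcs T2 \<subseteq> ?I \<times> ?I"
    "sym (map_prod h2 h2 ` parcs T2)" "irrefl (map_prod h2 h2 ` parcs T2)"
    "noncrossing (map_prod h2 h2 ` parcs T2)"
    using undirected_tree_centered_embedding[OF assms(4,5)] .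
  obtain h3 where h3: "bij_betw h3 (pverts T3) ?I" "map_prod h3 h3 ` parcs T3 \<subseteq> ?I \<times> ?I"
    "sym (map_prod h3 h3 ` parcs T3)" "irrefl (map_prod h3 h3 ` parcs T3)"
    "noncrossing (map_prod h3 h3 ` parcs T3)"
    using undirected_tree_centered_embedding[OF assms(6,7)] .
  \<comment> \<open>The orderings turn all three trees into relations on the reals, which fit into
    one family indexed by the sector.\<close>
  define R where "R m = (if m = 0 then map_prod h1 h1 ` parcs T1
    else if m = 1 then map_prod h2 h2 ` parcs T2 else map_prod h3 h3 ` parcs T3)" for m :: nat
  have "\<exists>G :: nat pair_pre_digraph. planar_graph G \<and>
      card (pverts G) = card (\<Union>m<3. (\<lambda>i. sector m (i, 0)) ` ?I) \<and>
      (\<forall>m<3. \<exists>g. inj_on g ?I \<and> g ` ?I \<subseteq> pverts G \<and> (\<forall>(i, j) \<in> R m. (g i, g j) \<in> parcs G))"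
    by (rule planar_graph_of_three_sectors) (use h1 h2 h3 in \<open>simp_all add: R_def\<close>)
  then obtain G :: "nat pair_pre_digraph" where G: "planar_graph G"
      "card (pverts G) = card (\<Union>m<3. (\<lambda>i. sector m (i, 0)) ` ?I)"
    and emb: "\<And>m. m < 3 \<Longrightarrow> \<exists>g. inj_on g ?I \<and> g ` ?I \<subseteq> pverts G \<and>
      (\<forall>(i, j) \<in> R m. (g i, g j) \<in> parcs G)"
    by blast
  have "contains_as_subgraph G T1"
    using emb[of 0] by (intro contains_as_subgraph_via_ordering[OF h1(1)]) (simp add: R_def)
  moreover have "contains_as_subgraph G T2"
    using emb[of 1] by (intro contains_as_subgraph_via_ordering[OF h2(1)]) (simp add: R_def)
  moreover have "contains_as_subgraph G T3"
    using emb[of 2] by (intro contains_as_subgraph_via_ordering[OF h3(1)]) (simp add: R_def)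
  moreover have "real (card (pverts G)) \<le> 3 / 2 * real n"
    unfolding G(2) by (rule card_three_rays_le)
  ultimately show ?thesis using G(1) by blast
qed

end
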